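(* The set of elements of Thompson's group $F$ that have a rigid coloring forms a subgroup of $F$.
   Context: **Trees.** Finite binary trees are rooted, planar; every vertex has $0$ or two (ordered: left, right) children except the root $*$, which has degree $1$ and a single child $\emptyset$ (non-root vertices are addressed by words over $\{0,1\}$, the children of $u$ being $u0$ and $u1$). Leaves are numbered left to right; internal vertices are the vertices of degree $3$. All pairs $(D,R)$ of trees are assumed to have the same number of leaves. For a tree $A$ with at least $i$ leaves, $A^{(i)}$ denotes the tree obtained by attaching two children to the $i$-th leaf of $A$. **The group $F$.** Elements of $F$ are equivalence classes of pairs of finite binary trees with the same number of leaves, under the equivalence relation generated by $(A,B)\rightarrow(A^{(i)},B^{(i)})$. Multiplication is determined by $(A,B)(B,C)=(A,C)$: given $(A,B)$, $(C,D)$ one finds equivalent pairs $(A',E)$ and $(E,D')$ (e.g. with $E=B\cup C$) and sets the product to be $(A',D')$. **Colorings.** Colors are elements of $\mathbb Z_2\times\mathbb Z_2$, coded $0=(0,0)$, $1=(0,1)$, $2=(1,0)$, $3=(1,1)$. A color vector $\mathbf c=(c_1,\dots,c_n)$ for a tree with $n$ leaves determines the unique edge coloring in which the edge at the $i$-th leaf has color $c_i$ and the three edges at each internal vertex sum to $0$. It is valid for the tree if this is a proper edge coloring using only colors $1,2,3$; it is a coloring of a pair $(D,R)$ if it is valid for both trees. A valid color vector gives each internal vertex a derived sign: $+$ if the colors of its (parent edge, left child edge, right child edge) form a cyclic permutation of $(1,2,3)$, and $-$ otherwise. A sign assignment is rigid if any two adjacent internal vertices have opposite signs. A coloring of $(D,R)$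 is rigid if its derived sign assignments on $D$ and $R$ are rigid (rigidity on one of the two trees is equivalent to rigidity on the other). An element of $F$ has a rigid coloring if a pair representing it has a rigid coloring. *)

theory Defs
  imports "HOL-Algebra.Group" "HOL-Library.Z2" "HOL-Library.Product_Plus"
begin

section \<open>Finite binary trees\<close>

text \<open>
  A term of type \<open>btree\<close> describes a tree of the paper from the vertex \<open>\<emptyset>\<close> downwards: the root \<open>*\<close>
  and the edge joining it to \<open>\<emptyset>\<close> are present in every tree and are not recorded. Thus \<open>Leaf\<close> is the
  tree whose only edge joins \<open>*\<close> to \<open>\<emptyset>\<close>.
\<close>

datatype btree = Leaf | Node btree btree

text \<open>A non-root vertex is a word, with \<open>False\<close> for 0 (left) and \<open>True\<close> for 1 (right).\<close>

type_synonym vertex = "bool list"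

primrec leaf_list :: "btree \<Rightarrow> vertex list" where
  "leaf_list Leaf = [[]]"
| "leaf_list (Node l r) = map (Cons False) (leaf_list l) @ map (Cons True) (leaf_list r)"

primrec leaves :: "btree \<Rightarrow> nat" where
  "leaves Leaf = 1"
| "leaves (Node l r) = leaves l + leaves r"

primrec internal :: "btree \<Rightarrow> vertex set" where
  "internal Leaf = {}"
| "internal (Node l r) = insert [] (Cons False ` internal l \<union> Cons True ` internal r)"

definition vertices :: "btree \<Rightarrow> vertex set" where
  "vertices T = internal T \<union> set (leaf_list T)"

text \<open>Leaves are numbered from 1; \<open>attach i A\<close> is \<open>A\<^sup>(\<^sup>i\<^sup>)\<close>, meaningful for \<open>1 \<le> i \<le> leaves A\<close>.\<close>

primrec attach :: "nat \<Rightarrow> btree \<Rightarrow> btree" where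
  "attach i Leaf = Node Leaf Leaf"
| "attach i (Node l r) =
     (if i \<le> leaves l then Node (attach i l) r else Node l (attach (i - leaves l) r))"


section \<open>Thompson's group F\<close>

definition tree_pairs :: "(btree \<times> btree) set" where
  "tree_pairs = {(A, B). leaves A = leaves B}"

definition expansion :: "((btree \<times> btree) \<times> (btree \<times> btree)) set" where
  "expansion = {((A, B), (attach i A, attach i B)) | A B i.
     (A, B) \<in> tree_pairs \<and> 1 \<le> i \<and> i \<le> leaves A}"

definition F_equiv :: "((btree \<times> btree) \<times> (btree \<times> btree)) set" where
  "F_equiv = Restr ((expansion \<union> expansion\<inverse>)\<^sup>*) tree_pairs"

definition F_class :: "btree \<Rightarrow> btree \<Rightarrow> (btree \<times> btree) set" where
  "F_class A B = F_equiv `` {(A, B)}"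

text \<open>
  In the product, the classes united are all equal: see \<open>F_mult_class\<close> below, which is the rule
  \<open>(A, B) (B, C) = (A, C)\<close>, and \<open>F_common_middle\<close>, which says that the rule always applies.
\<close>

definition thompson_F :: "(btree \<times> btree) set monoid" where
  "thompson_F = \<lparr>carrier = tree_pairs // F_equiv,
     mult = (\<lambda>X Y. \<Union> {F_class A C | A C. \<exists>E. (A, E) \<in> X \<and> (E, C) \<in> Y}),
     one = F_class Leaf Leaf\<rparr>"


section \<open>Colorings\<close>

type_synonym color = "bit \<times> bit"

definition col1 :: color where "col1 = (0, 1)"
definition col2 :: color where "col2 = (1, 0)"
definition col3 :: color where "col3 = (1, 1)"

text \<open>
  An edge coloring is a function on words, the word \<open>u\<close> standing for the edge from \<open>u\<close> up to its
  parent. So the edges at an internal vertex \<open>u\<close> are \<open>u\<close> (parent edge), \<open>u0\<close> and \<open>u1\<close>.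
  The value 0 outside the tree only serves to make the coloring unique as a function on all words.
\<close>

definition is_edge_coloring :: "btree \<Rightarrow> color list \<Rightarrow> (vertex \<Rightarrow> color) \<Rightarrow> bool" where
  "is_edge_coloring T c \<chi> \<longleftrightarrow>
     map \<chi> (leaf_list T) = c \<and>
     (\<forall>u\<in>internal T. \<chi> u + \<chi> (u @ [False]) + \<chi> (u @ [True]) = 0) \<and>
     (\<forall>u. u \<notin> vertices T \<longrightarrow> \<chi> u = 0)"

text \<open>Well defined for \<open>length c = leaves T\<close>, by \<open>ex1_edge_coloring\<close> below.\<close>

definition edge_coloring :: "btree \<Rightarrow> color list \<Rightarrow> vertex \<Rightarrow> color" where
  "edge_coloring T c = (THE \<chi>. is_edge_coloring T c \<chi>)"

definition valid_coloring :: "btree \<Rightarrow> color list \<Rightarrow> bool" where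
  "valid_coloring T c \<longleftrightarrow> length c = leaves T \<and>
     (let \<chi> = edge_coloring T c in
       (\<forall>u\<in>vertices T. \<chi> u \<in> {col1, col2, col3}) \<and>
       (\<forall>u\<in>internal T. distinct [\<chi> u, \<chi> (u @ [False]), \<chi> (u @ [True])]))"

datatype vsign = Plus | Minus

definition derived_sign :: "btree \<Rightarrow> color list \<Rightarrow> vertex \<Rightarrow> vsign" where
  "derived_sign T c u = (let \<chi> = edge_coloring T c in
     if (\<chi> u, \<chi> (u @ [False]), \<chi> (u @ [True]))
          \<in> {(col1, col2, col3), (col2, col3, col1), (col3, col1, col2)}
     then Plus else Minus)"

definition rigid :: "btree \<Rightarrow> (vertex \<Rightarrow> vsign) \<Rightarrow> bool" where
  "rigid T \<sigma> \<longleftrightarrow> (\<forall>u\<in>internal T. \<forall>b. u @ [b] \<in> internal T \<longrightarrow> \<sigma> u \<noteq> \<sigma> (u @ [b]))"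

definition pair_coloring :: "btree \<times> btree \<Rightarrow> color list \<Rightarrow> bool" where
  "pair_coloring P c \<longleftrightarrow> valid_coloring (fst P) c \<and> valid_coloring (snd P) c"

definition rigid_coloring :: "btree \<times> btree \<Rightarrow> color list \<Rightarrow> bool" where
  "rigid_coloring P c \<longleftrightarrow> pair_coloring P c \<and>
     rigid (fst P) (derived_sign (fst P) c) \<and> rigid (snd P) (derived_sign (snd P) c)"

definition has_rigid_coloring :: "(btree \<times> btree) set \<Rightarrow> bool" where
  "has_rigid_coloring g \<longleftrightarrow> (\<exists>P\<in>g. \<exists>c. rigid_coloring P c)"


section \<open>A color vector determines a unique edge coloring\<close>

lemma length_leaf_list [simp]: "length (leaf_list T) = leaves T"
  by (induction T) auto

lemma vertices_Leaf: "vertices Leaf = {[]}"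
  by (simp add: vertices_def)

lemma vertices_Node:
  "vertices (Node l r) = insert [] (Cons False ` vertices l \<union> Cons True ` vertices r)"
  by (auto simp: vertices_def)

lemma bit_add_self: "(x :: bit) + x = 0"
  by (cases x) auto

lemma color_add_self: "(x :: color) + x = 0"
  by (cases x) (simp add: bit_add_self zero_prod_def)

lemma color_add_eq_0: "(x :: color) + y + z = 0 \<longleftrightarrow> x = y + z"
proof
  assume "x + y + z = 0"
  then have "x + (y + z) + (y + z) = y + z" by (simp add: add.assoc)
  then show "x = y + z" by (simp only: add.assoc[of x] color_add_self add_0_right)
next
  assume "x = y + z"
  then have "x + y + z = (y + z) + (y + z)" by (simp only: add.assoc)
  then show "x + y + z = 0" by (simp only: color_add_self)
qed

lemma is_edge_coloring_Node:
  assumes "length c = leaves l + leaves r"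
  shows "is_edge_coloring (Node l r) c \<chi> \<longleftrightarrow>
     is_edge_coloring l (take (leaves l) c) (\<lambda>u. \<chi> (False # u)) \<and>
     is_edge_coloring r (drop (leaves l) c) (\<lambda>u. \<chi> (True # u)) \<and>
     \<chi> [] = \<chi> [False] + \<chi> [True]"
proof -
  have 1: "map \<chi> (leaf_list (Node l r)) = c \<longleftrightarrow>
     map (\<lambda>u. \<chi> (False # u)) (leaf_list l) = take (leaves l) c \<and>
     map (\<lambda>u. \<chi> (True # u)) (leaf_list r) = drop (leaves l) c"
    using assms append_eq_conv_conj[of "map (\<lambda>u. \<chi> (False # u)) (leaf_list l)"
        "map (\<lambda>u. \<chi> (True # u)) (leaf_list r)" c]
    by (simp add: comp_def)
  have 2: "(\<forall>u. u \<notin> vertices (Node l r) \<longrightarrow> \<chi> u = 0) \<longleftrightarrow>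
     (\<forall>u. u \<notin> vertices l \<longrightarrow> \<chi> (False # u) = 0) \<and> (\<forall>u. u \<notin> vertices r \<longrightarrow> \<chi> (True # u) = 0)"
    (is "?L \<longleftrightarrow> ?R")
  proof
    assume L: ?L
    have "False # u \<in> vertices (Node l r) \<longleftrightarrow> u \<in> vertices l"
      "True # u \<in> vertices (Node l r) \<longleftrightarrow> u \<in> vertices r" for u
      by (auto simp: vertices_Node)
    with L show ?R by blast
  next
    assume R: ?R
    show ?L
    proof (intro allI impI)
      fix u assume u: "u \<notin> vertices (Node l r)"
      then obtain b v where "u = b # v" by (cases u) (auto simp: vertices_Node)
      with u R show "\<chi> u = 0" by (cases b) (auto simp: vertices_Node)
    qed
  qed
  show ?thesis
    unfolding is_edge_coloring_def 1 2
    by (simp add: color_add_eq_0 ball_Un conj_ac)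
qed

lemma ex1_edge_coloring: "length c = leaves T \<Longrightarrow> \<exists>!\<chi>. is_edge_coloring T c \<chi>"
proof (induction T arbitrary: c)
  case Leaf
  then obtain x where c: "c = [x]" by (auto simp: length_Suc_conv)
  show ?case
  proof (rule ex1I)
    show "is_edge_coloring Leaf c (\<lambda>u. if u = [] then x else 0)"
      by (auto simp: is_edge_coloring_def c vertices_Leaf)
  next
    fix \<chi> assume "is_edge_coloring Leaf c \<chi>"
    then show "\<chi> = (\<lambda>u. if u = [] then x else 0)"
      by (auto simp: is_edge_coloring_def c vertices_Leaf)
  qed
next
  case (Node l r)
  then have len: "length c = leaves l + leaves r" by simp
  obtain f where f: "is_edge_coloring l (take (leaves l) c) f"
    and f_unique: "\<And>f'. is_edge_coloring l (take (leaves l) c) f' \<Longrightarrow> f' = f"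
    using Node.IH(1)[of "take (leaves l) c"] len by auto
  obtain g where g: "is_edge_coloring r (drop (leaves l) c) g"
    and g_unique: "\<And>g'. is_edge_coloring r (drop (leaves l) c) g' \<Longrightarrow> g' = g"
    using Node.IH(2)[of "drop (leaves l) c"] len by auto
  define h where
    "h = (\<lambda>u. case u of [] \<Rightarrow> f [] + g [] | b # v \<Rightarrow> if b then g v else f v)"
  show ?case
  proof (rule ex1I)
    show "is_edge_coloring (Node l r) c h"
      using f g unfolding is_edge_coloring_Node[OF len] by (simp add: h_def)
  next
    fix \<chi> assume "is_edge_coloring (Node l r) c \<chi>"
    then have *: "(\<lambda>u. \<chi> (False # u)) = f" "(\<lambda>u. \<chi> (True # u)) = g"
      "\<chi> [] = \<chi> [False] + \<chi> [True]"
      unfolding is_edge_coloring_Node[OF len] by (auto intro: f_unique g_unique)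
    show "\<chi> = h"
    proof
      fix u show "\<chi> u = h u"
        using *(3) fun_cong[OF *(1)] fun_cong[OF *(2)]
        by (cases u) (auto simp: h_def)
    qed
  qed
qed


section \<open>F is a group\<close>

text \<open>
  \<open>subst A fs\<close> hangs the trees in the list \<open>fs\<close> on the leaves of \<open>A\<close>, and \<open>substl\<close> does the same for a
  list of trees.
\<close>

primrec subst :: "btree \<Rightarrow> btree list \<Rightarrow> btree" where
  "subst Leaf fs = hd fs"
| "subst (Node l r) fs = Node (subst l (take (leaves l) fs)) (subst r (drop (leaves l) fs))"

primrec leavesl :: "btree list \<Rightarrow> nat" where
  "leavesl [] = 0"
| "leavesl (f # fs) = leaves f + leavesl fs"

primrec substl :: "btree list \<Rightarrow> btree list \<Rightarrow> btree list" where
  "substl [] hs = []"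
| "substl (f # fs) hs = subst f (take (leaves f) hs) # substl fs (drop (leaves f) hs)"

lemma leaves_pos [simp]: "0 < leaves T"
  by (induction T) auto

lemma leavesl_append [simp]: "leavesl (fs @ gs) = leavesl fs + leavesl gs"
  by (induction fs) auto

lemma length_substl [simp]: "length (substl fs hs) = length fs"
  by (induction fs arbitrary: hs) auto

lemma substl_append:
  "substl (fs @ gs) hs = substl fs (take (leavesl fs) hs) @ substl gs (drop (leavesl fs) hs)"
  by (induction fs arbitrary: hs) (auto simp: take_drop add.commute min_def)

lemma leaves_subst: "length fs = leaves A \<Longrightarrow> leaves (subst A fs) = leavesl fs"
proof (induction A arbitrary: fs)
  case Leaf
  then show ?case by (auto simp: length_Suc_conv)
next
  case (Node l r)
  have "leavesl fs = leavesl (take (leaves l) fs) + leavesl (drop (leaves l) fs)"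
    by (metis append_take_drop_id leavesl_append)
  then show ?case using Node by simp
qed

lemma subst_subst:
  "length fs = leaves A \<Longrightarrow> length hs = leavesl fs \<Longrightarrow> subst (subst A fs) hs = subst A (substl fs hs)"
proof (induction A arbitrary: fs hs)
  case Leaf
  then show ?case by (auto simp: length_Suc_conv)
next
  case (Node l r)
  define f1 f2 where "f1 = take (leaves l) fs" and "f2 = drop (leaves l) fs"
  have fs: "fs = f1 @ f2" "length f1 = leaves l" "length f2 = leaves r"
    using Node.prems by (auto simp: f1_def f2_def)
  show ?case
    using Node.IH(1)[of f1 "take (leavesl f1) hs"] Node.IH(2)[of f2 "drop (leavesl f1) hs"]
      Node.prems fs
    by (simp add: leaves_subst substl_append)
qed

lemma subst_inject:
  "length fs = leaves A \<Longrightarrow> length gs = leaves A \<Longrightarrow> subst A fs = subst A gs \<Longrightarrow> fs = gs"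
proof (induction A arbitrary: fs gs)
  case Leaf
  then show ?case by (auto simp: length_Suc_conv)
next
  case (Node l r)
  have "take (leaves l) fs = take (leaves l) gs"
    using Node.prems by (intro Node.IH(1)) auto
  moreover have "drop (leaves l) fs = drop (leaves l) gs"
    using Node.prems by (intro Node.IH(2)) auto
  ultimately show ?case by (metis append_take_drop_id)
qed

lemma leavesl_replicate_Leaf [simp]: "leavesl (replicate n Leaf) = n"
  by (induction n) auto

lemma subst_Leafs: "subst A (replicate (leaves A) Leaf) = A"
  by (induction A) (auto simp: min_def)

lemma subst_join:
  "\<exists>fs gs. length fs = leaves A \<and> length gs = leaves B \<and> subst A fs = subst B gs"
proof (induction A arbitrary: B)
  case Leaf
  show ?case
    by (rule exI[of _ "[B]"], rule exI[of _ "replicate (leaves B) Leaf"]) (simp add: subst_Leafs)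
next
  case (Node l r)
  show ?case
  proof (cases B)
    case Leaf
    then show ?thesis
      by (intro exI[of _ "replicate (leaves (Node l r)) Leaf"] exI[of _ "[Node l r]"])
        (simp add: subst_Leafs min_def)
  next
    case B: (Node l' r')
    obtain f g where 1: "length f = leaves l" "length g = leaves l'" "subst l f = subst l' g"
      using Node.IH(1) by blast
    obtain f' g' where 2: "length f' = leaves r" "length g' = leaves r'" "subst r f' = subst r' g'"
      using Node.IH(2) by blast
    show ?thesis
      by (intro exI[of _ "f @ f'"] exI[of _ "g @ g'"]) (simp add: 1 2 B)
  qed
qed

lemma substl_join:
  assumes "length fs = leaves A" "length gs = leaves A"
  shows "\<exists>hs ks. length hs = leavesl fs \<and> length ks = leavesl gs \<and> substl fs hs = substl gs ks"
proof -
  obtain hs ks where *: "length hs = leaves (subst A fs)" "length ks = leaves (subst A gs)"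
    "subst (subst A fs) hs = subst (subst A gs) ks"
    using subst_join by blast
  then have "subst A (substl fs hs) = subst A (substl gs ks)"
    using assms by (simp add: subst_subst leaves_subst)
  then have "substl fs hs = substl gs ks"
    using assms by (intro subst_inject[of _ A]) auto
  with * assms show ?thesis by (auto simp: leaves_subst)
qed

lemma leaves_attach: "1 \<le> i \<Longrightarrow> i \<le> leaves A \<Longrightarrow> leaves (attach i A) = Suc (leaves A)"
  by (induction A arbitrary: i) auto

lemma attach_subst:
  "attach (Suc (length xs)) (subst A (xs @ Leaf # ys)) = subst A (xs @ Node Leaf Leaf # ys)"
  if "length xs + Suc (length ys) = leaves A" "leavesl xs = length xs"
  for xs ys
  using that
proof (induction A arbitrary: xs ys)
  case Leaf
  then show ?case by simp
next
  case (Node l r)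
  show ?case
  proof (cases "length xs < leaves l")
    case True
    define y1 y2 where "y1 = take (leaves l - Suc (length xs)) ys"
      and "y2 = drop (leaves l - Suc (length xs)) ys"
    have ys: "ys = y1 @ y2" "length y1 = leaves l - Suc (length xs)"
      using Node.prems True by (auto simp: y1_def y2_def)
    have "leaves (subst l (xs @ Leaf # y1)) = leavesl (xs @ Leaf # y1)"
      using ys True by (intro leaves_subst) auto
    then have "Suc (length xs) \<le> leaves (subst l (xs @ Leaf # y1))"
      using Node.prems by simp
    moreover have "attach (Suc (length xs)) (subst l (xs @ Leaf # y1))
        = subst l (xs @ Node Leaf Leaf # y1)"
      using Node.prems ys True by (intro Node.IH(1)) auto
    moreover have "take (leaves l) (xs @ z # ys) = xs @ z # y1"
        "drop (leaves l) (xs @ z # ys) = y2" for z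
      using ys True by (auto simp: take_Cons' drop_Cons')
    ultimately show ?thesis by simp
  next
    case False
    define x1 x2 where "x1 = take (leaves l) xs" and "x2 = drop (leaves l) xs"
    have xs: "xs = x1 @ x2" "length x1 = leaves l"
      using Node.prems False by (auto simp: x1_def x2_def)
    have ge: "length zs \<le> leavesl zs" for zs
    proof (induction zs)
      case (Cons a zs)
      then show ?case using leaves_pos[of a] by (simp del: leaves_pos)
    qed simp
    have x: "leavesl x1 = length x1" "leavesl x2 = length x2"
      using Node.prems(2) xs ge[of x1] ge[of x2] by auto
    have "leaves (subst l x1) = leaves l"
      using xs x by (simp add: leaves_subst)
    moreover have "attach (Suc (length x2)) (subst r (x2 @ Leaf # ys))
        = subst r (x2 @ Node Leaf Leaf # ys)"
      using Node.prems xs x by (intro Node.IH(2)) auto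
    ultimately show ?thesis
      using xs by (simp add: Suc_diff_le)
  qed
qed

definition sprout :: "nat \<Rightarrow> nat \<Rightarrow> btree list" where
  "sprout n i = replicate (i - 1) Leaf @ Node Leaf Leaf # replicate (n - i) Leaf"

lemma length_sprout [simp]: "1 \<le> i \<Longrightarrow> i \<le> n \<Longrightarrow> length (sprout n i) = n"
  by (simp add: sprout_def)

lemma attach_conv_subst:
  assumes "1 \<le> i" "i \<le> leaves A"
  shows "attach i A = subst A (sprout (leaves A) i)"
proof -
  have "replicate (i - 1) Leaf @ Leaf # replicate (leaves A - i) Leaf
      = replicate ((i - 1) + Suc (leaves A - i)) Leaf"
    by (simp only: replicate_add replicate_Suc)
  also have "(i - 1) + Suc (leaves A - i) = leaves A" using assms by simp
  finally have "subst A (replicate (i - 1) Leaf @ Leaf # replicate (leaves A - i) Leaf) = A"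
    by (simp add: subst_Leafs)
  then show ?thesis
    using attach_subst[of "replicate (i - 1) Leaf" "replicate (leaves A - i) Leaf" A] assms
    by (simp add: sprout_def)
qed

text \<open>Two pairs are equivalent iff they have a common expansion.\<close>

definition common_exp :: "btree \<times> btree \<Rightarrow> btree \<times> btree \<Rightarrow> bool" where
  "common_exp P Q \<longleftrightarrow> P \<in> tree_pairs \<and> Q \<in> tree_pairs \<and>
     (\<exists>fs gs. length fs = leaves (fst P) \<and> length gs = leaves (fst Q) \<and>
        subst (fst P) fs = subst (fst Q) gs \<and> subst (snd P) fs = subst (snd Q) gs)"

lemma common_exp_trans:
  assumes "common_exp P Q" "common_exp Q S"
  shows "common_exp P S"
proof -
  obtain A B A1 B1 A2 B2 where P: "P = (A, B)" "Q = (A1, B1)" "S = (A2, B2)"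
    by (cases P, cases Q, cases S) auto
  have l: "leaves A = leaves B" "leaves A1 = leaves B1" "leaves A2 = leaves B2"
    using assms by (auto simp: common_exp_def tree_pairs_def P)
  obtain fs gs where 1: "length fs = leaves A" "length gs = leaves A1"
    "subst A fs = subst A1 gs" "subst B fs = subst B1 gs"
    using assms(1) by (auto simp: common_exp_def P)
  obtain hs ks where 2: "length hs = leaves A1" "length ks = leaves A2"
    "subst A1 hs = subst A2 ks" "subst B1 hs = subst B2 ks"
    using assms(2) by (auto simp: common_exp_def P)
  obtain xs ys where 3: "length xs = leavesl gs" "length ys = leavesl hs"
    "substl gs xs = substl hs ys"
    using substl_join[of gs A1 hs] 1 2 by blast
  have 4: "leavesl fs = leavesl gs" "leavesl hs = leavesl ks"
    using 1 2 by (metis leaves_subst)+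
  have "subst A (substl fs xs) = subst A2 (substl ks ys)"
    using 1 2 3 4 by (metis subst_subst)
  moreover have "subst B (substl fs xs) = subst B2 (substl ks ys)"
    using 1 2 3 4 l by (metis subst_subst)
  ultimately show ?thesis
    using 1 2 assms unfolding common_exp_def P fst_conv snd_conv
    by (metis length_substl)
qed

lemma common_exp_sym: "common_exp P Q \<Longrightarrow> common_exp Q P"
  unfolding common_exp_def by metis

lemma common_exp_refl: "P \<in> tree_pairs \<Longrightarrow> common_exp P P"
  unfolding common_exp_def by (metis length_replicate)

lemma common_exp_expansion: "(P, Q) \<in> expansion \<Longrightarrow> common_exp P Q"
proof -
  assume "(P, Q) \<in> expansion"
  then obtain A B i where *: "P = (A, B)" "Q = (attach i A, attach i B)"
    "leaves A = leaves B" "1 \<le> i" "i \<le> leaves A"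
    by (auto simp: expansion_def tree_pairs_def)
  show ?thesis
    unfolding common_exp_def
  proof (intro conjI exI)
    show "subst (fst P) (sprout (leaves A) i)
        = subst (fst Q) (replicate (leaves (attach i A)) Leaf)"
      using * attach_conv_subst[of i A] by (simp add: subst_Leafs)
    have "leaves (attach i A) = leaves (attach i B)"
      using * by (simp add: leaves_attach)
    then show "subst (snd P) (sprout (leaves A) i)
        = subst (snd Q) (replicate (leaves (attach i A)) Leaf)"
      using * attach_conv_subst[of i B] by (simp add: subst_Leafs)
  qed (use * in \<open>auto simp: tree_pairs_def leaves_attach\<close>)
qed

lemma substl_Leafs_left: "length hs = n \<Longrightarrow> substl (replicate n Leaf) hs = hs"
  by (induction n arbitrary: hs) (auto simp: length_Suc_conv)

lemma subst_attach:
  assumes "length xs + Suc (length ys) = leaves A"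
  shows "subst (attach (Suc (length xs)) A) (xs @ [l, r] @ ys) = subst A (xs @ Node l r # ys)"
proof -
  define i where "i = Suc (length xs)"
  have i: "1 \<le> i" "i \<le> leaves A" using assms by (auto simp: i_def)
  have "subst (attach i A) (xs @ [l, r] @ ys)
      = subst A (substl (sprout (leaves A) i) (xs @ [l, r] @ ys))"
    unfolding attach_conv_subst[OF i]
    by (rule subst_subst) (use i assms in \<open>auto simp: sprout_def i_def\<close>)
  also have "substl (sprout (leaves A) i) (xs @ [l, r] @ ys) = xs @ Node l r # ys"
  proof -
    have "leaves A - i = length ys" using assms by (simp add: i_def)
    then show ?thesis
      by (simp add: sprout_def substl_append substl_Leafs_left i_def)
  qed
  finally show ?thesis by (simp add: i_def)
qed

primrec nodes :: "btree \<Rightarrow> nat" where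
  "nodes Leaf = 0"
| "nodes (Node l r) = Suc (nodes l + nodes r)"

lemma expansions_subst:
  assumes "leaves A = leaves B" "length fs = leaves A"
  shows "((A, B), (subst A fs, subst B fs)) \<in> expansion\<^sup>*"
  using assms
proof (induction "sum_list (map nodes fs)" arbitrary: A B fs rule: less_induct)
  case less
  show ?case
  proof (cases "\<exists>t\<in>set fs. t \<noteq> Leaf")
    case False
    then have "fs = replicate (leaves A) Leaf"
      using less.prems by (metis replicate_length_same)
    then show ?thesis using less.prems subst_Leafs[of A] subst_Leafs[of B] by simp
  next
    case True
    then obtain xs t ys where fs: "fs = xs @ t # ys" "t \<noteq> Leaf"
      by (meson split_list)
    then obtain l r where t: "t = Node l r" by (cases t) auto
    define i where "i = Suc (length xs)"
    have i: "1 \<le> i" "i \<le> leaves A" using less.prems fs by (auto simp: i_def)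
    have len: "length xs + Suc (length ys) = leaves A" "length xs + Suc (length ys) = leaves B"
      using less.prems fs by auto
    have step: "((A, B), (attach i A, attach i B)) \<in> expansion"
      using i less.prems by (auto simp: expansion_def tree_pairs_def)
    have "((attach i A, attach i B),
        (subst (attach i A) (xs @ [l, r] @ ys), subst (attach i B) (xs @ [l, r] @ ys)))
        \<in> expansion\<^sup>*"
      using less.prems i len by (intro less.hyps) (auto simp: fs t leaves_attach)
    then show ?thesis
      using step subst_attach[OF len(1), of l r] subst_attach[OF len(2), of l r]
      by (simp add: i_def fs t converse_rtrancl_into_rtrancl)
  qed
qed

lemma F_equiv_iff: "(P, Q) \<in> F_equiv \<longleftrightarrow> common_exp P Q"
proof
  assume "(P, Q) \<in> F_equiv"
  then have P: "P \<in> tree_pairs" and "(P, Q) \<in> (expansion \<union> expansion\<inverse>)\<^sup>*"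
    by (auto simp: F_equiv_def)
  from this(2) show "common_exp P Q"
  proof (induction rule: rtrancl_induct)
    case base
    then show ?case by (rule common_exp_refl[OF P])
  next
    case (step Q S)
    then show ?case
      by (meson Un_iff converse_iff common_exp_expansion common_exp_sym common_exp_trans)
  qed
next
  assume PQ: "common_exp P Q"
  then have l: "leaves (fst P) = leaves (snd P)" "leaves (fst Q) = leaves (snd Q)"
    by (auto simp: common_exp_def tree_pairs_def)
  from PQ obtain fs gs where *: "length fs = leaves (fst P)" "length gs = leaves (fst Q)"
    "subst (fst P) fs = subst (fst Q) gs" "subst (snd P) fs = subst (snd Q) gs"
    by (auto simp: common_exp_def)
  define S where "S = (subst (fst P) fs, subst (snd P) fs)"
  have "(P, S) \<in> expansion\<^sup>*"
    using expansions_subst[OF l(1) *(1)] by (simp add: S_def)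
  moreover have "(Q, S) \<in> expansion\<^sup>*"
    using expansions_subst[OF l(2) *(2)] * by (simp add: S_def)
  ultimately have "(P, S) \<in> (expansion \<union> expansion\<inverse>)\<^sup>*" "(S, Q) \<in> (expansion \<union> expansion\<inverse>)\<^sup>*"
    by (auto intro: in_rtrancl_UnI simp: rtrancl_converse)
  then have "(P, Q) \<in> (expansion \<union> expansion\<inverse>)\<^sup>*" by (rule rtrancl_trans)
  then show "(P, Q) \<in> F_equiv"
    using PQ by (auto simp: F_equiv_def common_exp_def)
qed

lemma equiv_F: "equiv tree_pairs F_equiv"
proof (rule equivI)
  show "F_equiv \<subseteq> tree_pairs \<times> tree_pairs" by (auto simp: F_equiv_def)
  show "refl_on tree_pairs F_equiv"
    unfolding refl_on_def F_equiv_iff by (auto intro: common_exp_refl)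
  show "sym F_equiv" unfolding sym_def F_equiv_iff by (auto intro: common_exp_sym)
  show "trans F_equiv" unfolding trans_def F_equiv_iff by (auto intro: common_exp_trans)
qed

lemma F_class_eq_iff:
  "leaves A = leaves B \<Longrightarrow> leaves C = leaves D \<Longrightarrow>
     F_class A B = F_class C D \<longleftrightarrow> common_exp (A, B) (C, D)"
  unfolding F_class_def F_equiv_iff[symmetric]
  by (rule eq_equiv_class_iff[OF equiv_F]) (auto simp: tree_pairs_def)

lemma mem_F_class: "(C, D) \<in> F_class A B \<longleftrightarrow> common_exp (A, B) (C, D)"
  by (simp add: F_class_def F_equiv_iff)

lemma F_class_subst:
  assumes "leaves A = leaves B" "length fs = leaves A"
  shows "F_class (subst A fs) (subst B fs) = F_class A B"
proof -
  have "common_exp (A, B) (subst A fs, subst B fs)"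
    unfolding F_equiv_iff[symmetric] F_equiv_def
    using expansions_subst[OF assms] assms
    by (auto intro: in_rtrancl_UnI simp: tree_pairs_def leaves_subst)
  then show ?thesis
    using assms by (subst eq_commute) (simp add: F_class_eq_iff leaves_subst)
qed

lemma F_carrierE:
  assumes "X \<in> carrier thompson_F"
  obtains A B where "leaves A = leaves B" "X = F_class A B"
  using assms by (auto simp: thompson_F_def quotient_def F_class_def tree_pairs_def)

lemma F_class_carrier: "leaves A = leaves B \<Longrightarrow> F_class A B \<in> carrier thompson_F"
  by (auto simp: thompson_F_def quotient_def F_class_def tree_pairs_def)

lemma F_common_middle:
  assumes "X \<in> carrier thompson_F" "Y \<in> carrier thompson_F"
  obtains A E C where "leaves A = leaves E" "leaves E = leaves C"
    "X = F_class A E" "Y = F_class E C"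
proof -
  obtain A B where X: "leaves A = leaves B" "X = F_class A B"
    using assms(1) by (rule F_carrierE)
  obtain B' C where Y: "leaves B' = leaves C" "Y = F_class B' C"
    using assms(2) by (rule F_carrierE)
  obtain fs gs where *: "length fs = leaves B" "length gs = leaves B'" "subst B fs = subst B' gs"
    using subst_join by blast
  show thesis
  proof
    show "X = F_class (subst A fs) (subst B fs)" using X *(1) by (simp add: F_class_subst)
    show "Y = F_class (subst B fs) (subst C gs)" unfolding *(3) using Y *(2) by (simp add: F_class_subst)
    show "leaves (subst A fs) = leaves (subst B fs)" using X *(1) by (simp add: leaves_subst)
    have "leaves (subst B' gs) = leaves (subst C gs)" using Y * by (simp add: leaves_subst)
    then show "leaves (subst B fs) = leaves (subst C gs)" using * by simp
  qed
qed

lemma common_exp_mult: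
  assumes "common_exp (A, B) (A1, B1)" "common_exp (B, C) (B1, C1)"
  shows "common_exp (A, C) (A1, C1)"
proof -
  have l: "leaves A = leaves B" "leaves A1 = leaves B1" "leaves B = leaves C" "leaves B1 = leaves C1"
    using assms by (auto simp: common_exp_def tree_pairs_def)
  obtain fs gs where 1: "length fs = leaves B" "length gs = leaves B1"
    "subst A fs = subst A1 gs" "subst B fs = subst B1 gs"
    using assms(1) l by (auto simp: common_exp_def)
  obtain hs ks where 2: "length hs = leaves B" "length ks = leaves B1"
    "subst B hs = subst B1 ks" "subst C hs = subst C1 ks"
    using assms(2) l by (auto simp: common_exp_def)
  obtain xs ys where 3: "length xs = leavesl fs" "length ys = leavesl hs"
    "substl fs xs = substl hs ys"
    using substl_join[of fs B hs] 1 2 by blast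
  have 4: "leavesl fs = leavesl gs" "leavesl hs = leavesl ks"
    using 1 2 by (metis leaves_subst)+
  have "subst B1 (substl gs xs) = subst B1 (substl ks ys)"
    using 1 2 3 4 by (metis subst_subst)
  then have 5: "substl gs xs = substl ks ys"
    using 1 2 by (intro subst_inject[of _ B1]) auto
  have "subst A (substl fs xs) = subst A1 (substl gs xs)"
    using 1 3 4 l by (metis subst_subst)
  moreover have "subst C (substl fs xs) = subst C1 (substl gs xs)"
    using 2 3 4 5 l by (metis subst_subst)
  moreover have "(A, C) \<in> tree_pairs" "(A1, C1) \<in> tree_pairs"
    using l by (auto simp: tree_pairs_def)
  ultimately show ?thesis
    using 1 l unfolding common_exp_def fst_conv snd_conv by (metis length_substl)
qed

lemma F_mult_class:
  assumes "leaves A = leaves B" "leaves B = leaves C"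
  shows "F_class A B \<otimes>\<^bsub>thompson_F\<^esub> F_class B C = F_class A C"
proof -
  have "F_class A1 C1 = F_class A C"
    if "(A1, E) \<in> F_class A B" "(E, C1) \<in> F_class B C" for A1 E C1
  proof -
    have "common_exp (A, C) (A1, C1)"
      using that by (auto simp: mem_F_class intro: common_exp_mult)
    moreover from this have "leaves A = leaves C" "leaves A1 = leaves C1"
      by (auto simp: common_exp_def tree_pairs_def)
    ultimately show ?thesis by (simp add: F_class_eq_iff common_exp_sym)
  qed
  moreover have "(A, B) \<in> F_class A B" "(B, C) \<in> F_class B C"
    using assms by (auto simp: mem_F_class tree_pairs_def intro: common_exp_refl)
  ultimately have "{F_class A1 C1 | A1 C1. \<exists>E. (A1, E) \<in> F_class A B \<and> (E, C1) \<in> F_class B C}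
      = {F_class A C}"
    by blast
  then show ?thesis by (simp add: thompson_F_def)
qed

lemma F_class_diag: "F_class A A = \<one>\<^bsub>thompson_F\<^esub>"
  using F_class_subst[of Leaf Leaf "[A]"] by (simp add: thompson_F_def)

theorem group_thompson_F: "group thompson_F"
proof (rule groupI)
  show "\<one>\<^bsub>thompson_F\<^esub> \<in> carrier thompson_F"
    using F_class_carrier[of Leaf Leaf] by (simp add: F_class_diag)
next
  fix X Y assume "X \<in> carrier thompson_F" "Y \<in> carrier thompson_F"
  then show "X \<otimes>\<^bsub>thompson_F\<^esub> Y \<in> carrier thompson_F"
    by (rule F_common_middle) (simp add: F_mult_class F_class_carrier)
next
  fix X assume "X \<in> carrier thompson_F"
  then obtain A B where X: "leaves A = leaves B" "X = F_class A B" by (rule F_carrierE)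
  show "\<one>\<^bsub>thompson_F\<^esub> \<otimes>\<^bsub>thompson_F\<^esub> X = X"
    using F_mult_class[of A A B] X by (simp add: F_class_diag)
  show "\<exists>Y\<in>carrier thompson_F. Y \<otimes>\<^bsub>thompson_F\<^esub> X = \<one>\<^bsub>thompson_F\<^esub>"
    using F_mult_class[of B A B] X F_class_carrier[of B A] by (auto simp: F_class_diag)
next
  fix X Y Z
  assume XYZ: "X \<in> carrier thompson_F" "Y \<in> carrier thompson_F" "Z \<in> carrier thompson_F"
  obtain A B where X: "leaves A = leaves B" "X = F_class A B"
    using XYZ(1) by (rule F_carrierE)
  obtain B' C D where YZ: "leaves B' = leaves C" "leaves C = leaves D"
    "Y = F_class B' C" "Z = F_class C D"
    using XYZ(2,3) by (rule F_common_middle)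
  obtain fs gs where *: "length fs = leaves B" "length gs = leaves B'" "subst B fs = subst B' gs"
    using subst_join by blast
  define A2 B2 C2 D2 where "A2 = subst A fs" and "B2 = subst B fs"
    and "C2 = subst C gs" and "D2 = subst D gs"
  have "leaves (subst B' gs) = leaves C2"
    using YZ * by (simp add: C2_def leaves_subst)
  moreover have "leaves B2 = leaves (subst B' gs)"
    using * by (simp add: B2_def)
  ultimately have l: "leaves A2 = leaves B2" "leaves B2 = leaves C2" "leaves C2 = leaves D2"
    using X(1) YZ(1,2) *(1,2) by (simp_all add: A2_def B2_def C2_def D2_def leaves_subst)
  have e: "X = F_class A2 B2" "Y = F_class B2 C2" "Z = F_class C2 D2"
    using F_class_subst[of A B fs] F_class_subst[of B' C gs] F_class_subst[of C D gs] X YZ *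
    by (auto simp: A2_def B2_def C2_def D2_def)
  show "X \<otimes>\<^bsub>thompson_F\<^esub> Y \<otimes>\<^bsub>thompson_F\<^esub> Z = X \<otimes>\<^bsub>thompson_F\<^esub> (Y \<otimes>\<^bsub>thompson_F\<^esub> Z)"
    using l by (simp add: e F_mult_class)
qed

lemma inv_F_class:
  assumes "leaves A = leaves B"
  shows "inv\<^bsub>thompson_F\<^esub> (F_class A B) = F_class B A"
  using assms F_mult_class[of B A B]
  by (intro group.inv_equality[OF group_thompson_F]) (auto simp: F_class_diag F_class_carrier)

end

theory Submission
  imports Defs
begin

text \<open>
  The three edges at an internal vertex of a properly colored tree carry the three colors, so they
  form a \<^emph>\<open>frame\<close>: an ordering (parent, left, right) of the colors, whose parity is the derived sign.
  If \<open>(p, l, r)\<close> is the frame at \<open>u\<close>, then the parent edge of \<open>u0\<close> has color \<open>l\<close>, and rigidity asks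
  the frame at \<open>u0\<close> to have the other parity; this leaves only \<open>(l, p, r)\<close>. In the same way the
  frame at \<open>u1\<close> is \<open>(r, l, p)\<close>. Hence a rigid coloring is the unfolding of one arbitrary frame at
  the top of the tree (\<open>rigid_valid_iff_leaf_frames\<close>), and it gives a frame to every leaf as well,
  namely the one which a vertex would have if it were grown there.

  The main point is that the color vector of a rigid coloring of a pair already determines the leaf
  frames, so that both trees induce the same ones (\<open>ex_rigid_coloring_iff\<close>). Indeed a leaf with
  frame \<open>(c, u, v)\<close> can only be followed by a leaf with frame \<open>(c, v, u)\<close> or \<open>(v, c, u)\<close>, whatever
  the tree is. Two frames with the same color that differ are \<open>(c, u, v)\<close> and \<open>(c, v, u)\<close>. If these
  occur at the same leaf for the two trees, then the colors of the next leaf can be equal only if both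
  of them are \<open>c\<close>, and then the frames differ there again. On the other hand, equal frames with
  successors of equal color have equal successors. So a disagreement anywhere starts at the first
  leaf and forces all leaves to have the same color, which is impossible as soon as there is one
  internal vertex.

  With this, the frames extend a rigid coloring over every expansion of the pair. Two elements of
  \<open>F\<close> can therefore be represented as \<open>(A, E)\<close> and \<open>(E, C)\<close>, both with rigid colorings. The two
  colorings of \<open>E\<close> unfold from two frames, and a permutation of the colors carries one to the other;
  after applying it, they agree and give a rigid coloring of \<open>(A, C)\<close>.
\<close>


section \<open>Frames\<close>

type_synonym frame = "color \<times> color \<times> color"

text \<open>As there are three colors, the equation of sets also makes \<open>p\<close>, \<open>l\<close>, \<open>r\<close> distinct.\<close>

definition proper :: "frame \<Rightarrow> bool" where
  "proper = (\<lambda>(p, l, r). {p, l, r} = {col1, col2, col3})"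

definition even_frame :: "frame \<Rightarrow> bool" where
  "even_frame f \<longleftrightarrow> f \<in> {(col1, col2, col3), (col2, col3, col1), (col3, col1, col2)}"

text \<open>
  The frame of a child (\<open>False\<close> for the left one): a transposition, chosen so that the color of the
  shared edge comes first.
\<close>

fun child :: "bool \<Rightarrow> frame \<Rightarrow> frame" where
  "child False (p, l, r) = (l, p, r)"
| "child True (p, l, r) = (r, l, p)"

definition frame_at :: "frame \<Rightarrow> vertex \<Rightarrow> frame" where
  "frame_at x u = fold child u x"

definition leaf_frames :: "btree \<Rightarrow> frame \<Rightarrow> frame list" where
  "leaf_frames T x = map (frame_at x) (leaf_list T)"

lemma col_distinct [simp]:
  "col1 \<noteq> col2" "col1 \<noteq> col3" "col2 \<noteq> col3" "col2 \<noteq> col1" "col3 \<noteq> col1" "col3 \<noteq> col2"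
  by (simp_all add: col1_def col2_def col3_def)

lemma proper_iff:
  "proper f \<longleftrightarrow> f \<in> {(col1, col2, col3), (col2, col3, col1), (col3, col1, col2),
     (col1, col3, col2), (col3, col2, col1), (col2, col1, col3)}"
proof
  assume "proper f"
  obtain p l r where f: "f = (p, l, r)" by (cases f)
  have eq: "{p, l, r} = {col1, col2, col3}" using \<open>proper f\<close> by (simp add: proper_def f)
  have "p \<in> {p, l, r}" "l \<in> {p, l, r}" "r \<in> {p, l, r}" by simp_all
  then have mem: "p \<in> {col1, col2, col3}" "l \<in> {col1, col2, col3}" "r \<in> {col1, col2, col3}"
    by (simp_all only: eq)
  have "card {p, l, r} = 3" unfolding eq by simp
  then have "p \<noteq> l" "l \<noteq> r" "p \<noteq> r" by (auto simp: card_insert_if split: if_splits)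
  with mem show "f \<in> {(col1, col2, col3), (col2, col3, col1), (col3, col1, col2),
     (col1, col3, col2), (col3, col2, col1), (col2, col1, col3)}"
    unfolding f by (elim insertE emptyE) simp_all
next
  assume "f \<in> {(col1, col2, col3), (col2, col3, col1), (col3, col1, col2),
     (col1, col3, col2), (col3, col2, col1), (col2, col1, col3)}"
  then show "proper f" by (elim insertE emptyE) (simp_all add: proper_def insert_commute)
qed

lemma proper_child: "proper f \<Longrightarrow> proper (child b f)"
  unfolding proper_iff by (elim insertE emptyE; cases b; simp)

lemma proper_frame_at: "proper x \<Longrightarrow> proper (frame_at x u)"
  unfolding frame_at_def by (induction u arbitrary: x) (simp_all add: proper_child)

lemma ex_proper:
  assumes "p \<in> {col1, col2, col3}"
  obtains l r where "proper (p, l, r)"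
proof -
  have "proper (col1, col2, col3)" "proper (col2, col3, col1)" "proper (col3, col1, col2)"
    by (simp_all add: proper_iff)
  with assms that show thesis by blast
qed

lemma even_frame_child: "proper f \<Longrightarrow> even_frame (child b f) \<longleftrightarrow> \<not> even_frame f"
  unfolding proper_iff by (elim insertE emptyE; cases b; simp add: even_frame_def)

text \<open>
  Fixing the first color leaves two frames, which differ by a transposition. Thus a rigid coloring
  has no freedom in passing from a vertex to its child.
\<close>

lemma proper_eqI:
  "proper f \<Longrightarrow> proper g \<Longrightarrow> fst f = fst g \<Longrightarrow> even_frame f = even_frame g \<Longrightarrow> f = g"
  unfolding proper_iff by (elim insertE emptyE; simp add: even_frame_def)

lemma frame_at_Nil [simp]: "frame_at x [] = x"
  by (simp add: frame_at_def)

lemma frame_at_snoc [simp]: "frame_at x (u @ [b]) = child b (frame_at x u)"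
  by (simp add: frame_at_def)

lemma leaf_frames_Leaf [simp]: "leaf_frames Leaf x = [x]"
  by (simp add: leaf_frames_def)

lemma leaf_frames_Node [simp]:
  "leaf_frames (Node l r) x = leaf_frames l (child False x) @ leaf_frames r (child True x)"
  by (simp add: leaf_frames_def frame_at_def comp_def)

lemma length_leaf_frames [simp]: "length (leaf_frames T x) = leaves T"
  by (simp add: leaf_frames_def)

lemma leaf_frames_nonempty [simp]: "leaf_frames T x \<noteq> []"
  by (metis leaves_pos length_greater_0_conv length_leaf_frames)

lemma proper_leaf_frames: "proper x \<Longrightarrow> f \<in> set (leaf_frames T x) \<Longrightarrow> proper f"
  by (auto simp: leaf_frames_def proper_frame_at)


section \<open>Rigid colorings unfold from a frame\<close>

definition frame_of :: "(vertex \<Rightarrow> color) \<Rightarrow> vertex \<Rightarrow> frame" where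
  "frame_of \<chi> u = (\<chi> u, \<chi> (u @ [False]), \<chi> (u @ [True]))"

lemma edge_coloring_eqI:
  assumes "is_edge_coloring T c \<chi>"
  shows "edge_coloring T c = \<chi>"
proof -
  have len: "length c = leaves T"
    using assms by (auto simp: is_edge_coloring_def)
  show ?thesis
    unfolding edge_coloring_def by (intro the1_equality ex1_edge_coloring len assms)
qed

lemma is_edge_coloring_edge_coloring:
  "length c = leaves T \<Longrightarrow> is_edge_coloring T c (edge_coloring T c)"
  unfolding edge_coloring_def by (rule theI'[OF ex1_edge_coloring])

lemma snoc_vertices_iff: "u @ [b] \<in> vertices T \<longleftrightarrow> u \<in> internal T"
proof (induction T arbitrary: u)
  case Leaf
  then show ?case by (simp add: vertices_Leaf)
next
  case (Node l r)
  have *: "[] \<in> vertices T" for T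
    by (cases T) (auto simp: vertices_def)
  show ?case
    using Node *[of l] *[of r] by (cases u; cases b) (auto simp: vertices_Node image_iff)
qed

lemma internal_subset_vertices: "u \<in> internal T \<Longrightarrow> u \<in> vertices T"
  by (simp add: vertices_def)

lemma derived_sign_eq_even_frame:
  "derived_sign T c u = (if even_frame (frame_of (edge_coloring T c) u) then Plus else Minus)"
  by (simp add: derived_sign_def even_frame_def frame_of_def Let_def)

lemma proper_frame_ofI:
  assumes "\<chi> u \<in> {col1, col2, col3}" "\<chi> (u @ [False]) \<in> {col1, col2, col3}"
    "\<chi> (u @ [True]) \<in> {col1, col2, col3}"
    and "distinct [\<chi> u, \<chi> (u @ [False]), \<chi> (u @ [True])]"
  shows "proper (frame_of \<chi> u)"
  using assms unfolding frame_of_def by (elim insertE emptyE) (simp_all add: proper_iff)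

lemma rigid_valid_imp_leaf_frames:
  assumes "valid_coloring T c" "rigid T (derived_sign T c)"
  shows "\<exists>x. proper x \<and> map fst (leaf_frames T x) = c"
proof -
  define \<chi> where "\<chi> = edge_coloring T c"
  have \<chi>: "is_edge_coloring T c \<chi>"
    using assms(1) by (simp add: \<chi>_def valid_coloring_def is_edge_coloring_edge_coloring)
  have col: "\<chi> u \<in> {col1, col2, col3}" if "u \<in> vertices T" for u
    using assms(1) that by (simp add: \<chi>_def valid_coloring_def Let_def)
  have frames_proper: "proper (frame_of \<chi> u)" if "u \<in> internal T" for u
  proof (rule proper_frame_ofI)
    show "\<chi> u \<in> {col1, col2, col3}" "\<chi> (u @ [False]) \<in> {col1, col2, col3}"
      "\<chi> (u @ [True]) \<in> {col1, col2, col3}"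
      using that by (simp_all only: col snoc_vertices_iff internal_subset_vertices)
    show "distinct [\<chi> u, \<chi> (u @ [False]), \<chi> (u @ [True])]"
      using assms(1) that unfolding \<chi>_def valid_coloring_def Let_def by blast
  qed
  have top: "[] \<in> vertices T"
    by (cases T) (auto simp: vertices_def)
  \<comment> \<open>If \<open>T\<close> is a single edge, its color does not determine the frame, and any choice will do.\<close>
  obtain x where x: "proper x" "fst x = \<chi> []" "[] \<in> internal T \<Longrightarrow> x = frame_of \<chi> []"
  proof (cases "[] \<in> internal T")
    case True
    then show ?thesis
      using that[of "frame_of \<chi> []"] frames_proper[of "[]"] by (simp add: frame_of_def)
  next
    case False
    obtain l r where "proper (\<chi> [], l, r)" using ex_proper[OF col[OF top]] .
    with False show ?thesis using that[of "(\<chi> [], l, r)"] by simp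
  qed
  have *: "u \<in> internal T \<Longrightarrow> frame_of \<chi> u = frame_at x u" for u
  proof (induction u rule: rev_induct)
    case Nil
    then show ?case by (simp add: x(3))
  next
    case (snoc b u)
    have u: "u \<in> internal T"
      using snoc.prems internal_subset_vertices snoc_vertices_iff by blast
    have IH: "frame_of \<chi> u = frame_at x u" using snoc.IH u by simp
    have "derived_sign T c u \<noteq> derived_sign T c (u @ [b])"
      using assms(2) u snoc.prems by (auto simp: rigid_def)
    then have "even_frame (frame_of \<chi> (u @ [b])) \<longleftrightarrow> \<not> even_frame (frame_of \<chi> u)"
      by (auto simp: derived_sign_eq_even_frame \<chi>_def split: if_splits)
    then have "even_frame (frame_of \<chi> (u @ [b])) = even_frame (child b (frame_of \<chi> u))"
      by (simp only: even_frame_child[OF frames_proper[OF u]])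
    moreover have "fst (frame_of \<chi> (u @ [b])) = fst (child b (frame_of \<chi> u))"
      by (cases b) (simp_all add: frame_of_def)
    ultimately have "frame_of \<chi> (u @ [b]) = child b (frame_of \<chi> u)"
      using frames_proper[OF u] frames_proper[OF snoc.prems]
      by (intro proper_eqI) (simp_all only: proper_child)
    then show ?case by (simp add: IH)
  qed
  have "\<chi> u = fst (frame_at x u)" if "u \<in> vertices T" for u
  proof (cases u rule: rev_cases)
    case Nil
    then show ?thesis by (simp add: x(2))
  next
    case (snoc v b)
    then have "frame_at x v = frame_of \<chi> v"
      using that * by (simp add: snoc_vertices_iff)
    then show ?thesis unfolding snoc frame_at_snoc by (cases b) (simp_all add: frame_of_def)
  qed
  then have "map fst (leaf_frames T x) = map \<chi> (leaf_list T)"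
    by (simp add: leaf_frames_def vertices_def)
  also have "\<dots> = c" using \<chi> by (simp add: is_edge_coloring_def)
  finally show ?thesis using x(1) by blast
qed

lemma leaf_frames_imp_rigid_valid:
  fixes T :: btree and x :: frame
  assumes "proper x"
  defines "c \<equiv> map fst (leaf_frames T x)"
  shows "valid_coloring T c" "rigid T (derived_sign T c)"
proof -
  define \<chi> where "\<chi> = (\<lambda>u. if u \<in> vertices T then fst (frame_at x u) else 0)"
  have fr: "frame_of \<chi> u = frame_at x u" if "u \<in> internal T" for u
  proof -
    have "frame_of \<chi> u = (fst (frame_at x u), fst (child False (frame_at x u)),
        fst (child True (frame_at x u)))"
      using that by (simp add: frame_of_def \<chi>_def snoc_vertices_iff internal_subset_vertices)
    then show ?thesis by (cases "frame_at x u") simp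
  qed
  have frames_proper: "proper (frame_of \<chi> u)" if "u \<in> internal T" for u
    using that assms(1) by (simp add: fr proper_frame_at)
  have sum: "p + l + r = 0" if "proper (p, l, r)" for p l r
    using that by (auto simp: proper_iff col1_def col2_def col3_def zero_prod_def)
  have "is_edge_coloring T c \<chi>"
    unfolding is_edge_coloring_def
  proof (intro conjI ballI allI impI)
    show "map \<chi> (leaf_list T) = c"
      by (simp add: c_def leaf_frames_def \<chi>_def vertices_def)
    show "\<chi> u + \<chi> (u @ [False]) + \<chi> (u @ [True]) = 0" if "u \<in> internal T" for u
      using frames_proper[OF that] by (intro sum) (simp add: frame_of_def)
  qed (simp add: \<chi>_def)
  then have \<chi>: "edge_coloring T c = \<chi>" by (rule edge_coloring_eqI)
  have "fst f \<in> {col1, col2, col3}" if "proper f" for f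
    using that by (auto simp: proper_iff)
  then have "\<chi> u \<in> {col1, col2, col3}" if "u \<in> vertices T" for u
    using that assms(1) by (simp add: \<chi>_def proper_frame_at)
  moreover have "distinct [\<chi> u, \<chi> (u @ [False]), \<chi> (u @ [True])]" if "u \<in> internal T" for u
    using frames_proper[OF that] by (auto simp: proper_iff frame_of_def)
  ultimately show "valid_coloring T c"
    unfolding valid_coloring_def \<chi> Let_def by (simp add: c_def)
  show "rigid T (derived_sign T c)"
    unfolding rigid_def derived_sign_eq_even_frame \<chi>
    using assms(1) by (auto simp: fr even_frame_child proper_frame_at)
qed

lemma rigid_valid_iff_leaf_frames:
  "valid_coloring T c \<and> rigid T (derived_sign T c) \<longleftrightarrow>
     (\<exists>x. proper x \<and> map fst (leaf_frames T x) = c)"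
  using rigid_valid_imp_leaf_frames leaf_frames_imp_rigid_valid by blast


section \<open>The color vector determines the leaf frames\<close>

fun may_follow :: "frame \<Rightarrow> frame \<Rightarrow> bool" where
  "may_follow (c, u, v) f \<longleftrightarrow> f = (c, v, u) \<or> f = (v, c, u)"

text \<open>
  Along the leftmost branch the first two entries are swapped again and again, along the rightmost
  branch the first and the third.
\<close>

lemma hd_leaf_frames: "hd (leaf_frames T x) \<in> {x, child False x}"
proof (induction T arbitrary: x)
  case (Node l r)
  then show ?case using Node.IH(1)[of "child False x"] by (cases x) auto
qed simp

lemma last_leaf_frames: "last (leaf_frames T x) \<in> {x, child True x}"
proof (induction T arbitrary: x)
  case (Node l r)
  then show ?case using Node.IH(2)[of "child True x"] by (cases x) auto
qed simp

text \<open>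
  Consecutive leaves are the last leaf of the left subtree and the first leaf of the right subtree
  of some vertex, so only the two possibilities for each of these have to be compared.
\<close>

lemma may_follow_leaf_frames: "successively may_follow (leaf_frames T x)"
proof (induction T arbitrary: x)
  case (Node l r)
  have "may_follow (last (leaf_frames l (child False x))) (hd (leaf_frames r (child True x)))"
    using last_leaf_frames[of l "child False x"] hd_leaf_frames[of r "child True x"]
    by (cases x) auto
  then show ?case using Node by (simp add: successively_append_iff)
qed simp

lemma proper_same_color_cases:
  "proper (c, u, v) \<Longrightarrow> proper g \<Longrightarrow> fst g = c \<Longrightarrow> g = (c, u, v) \<or> g = (c, v, u)"
  by (auto simp: proper_iff)

text \<open>
  A disagreement at one leaf propagates to the next: the two frames there are obtained from
  \<open>(c, u, v)\<close> and \<open>(c, v, u)\<close>, whose only common successor color is \<open>c\<close>, by the same swap.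
\<close>

lemma colors_determine_may_follow_sequence:
  assumes "successively may_follow (f # fs)" "successively may_follow (g # gs)"
    and "map fst (f # fs) = map fst (g # gs)"
    and "\<forall>h\<in>set (f # fs) \<union> set (g # gs). proper h"
  shows "(f = g \<longrightarrow> fs = gs) \<and> (f \<noteq> g \<longrightarrow> (\<forall>h\<in>set fs. fst h = fst f))"
  using assms
proof (induction fs arbitrary: f g gs)
  case Nil
  then show ?case by simp
next
  case (Cons f' fs)
  obtain g' gs' where gs: "gs = g' # gs'" using Cons.prems(3) by (cases gs) auto
  have IH: "(f' = g' \<longrightarrow> fs = gs') \<and> (f' \<noteq> g' \<longrightarrow> (\<forall>h\<in>set fs. fst h = fst f'))"
    using Cons.prems unfolding gs by (intro Cons.IH) auto
  have step: "may_follow f f'" "may_follow g g'" "fst f' = fst g'" "proper f" "proper g"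
    "fst f = fst g"
    using Cons.prems by (auto simp: gs)
  obtain c u v where f: "f = (c, u, v)" by (cases f)
  have distinct: "c \<noteq> u" "c \<noteq> v" "u \<noteq> v"
    using step(4) unfolding f by (auto simp: proper_iff)
  have "g = (c, u, v) \<or> g = (c, v, u)"
    using step(4-6) by (intro proper_same_color_cases) (simp_all add: f)
  then show ?case
  proof
    assume g: "g = (c, u, v)"
    then have "f' = g'" using step(1-3) distinct by (auto simp: f)
    then show ?thesis using IH g by (simp add: gs f)
  next
    assume g: "g = (c, v, u)"
    \<comment> \<open>Leaving the color \<open>c\<close> would lead to \<open>v\<close> for \<open>f\<close> and to \<open>u\<close> for \<open>g\<close>.\<close>
    then have "f' = (c, v, u)" "g' = (c, u, v)"
      using step(1-3) distinct by (auto simp: f)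
    then show ?thesis using IH f g distinct by simp
  qed
qed

lemma leaf_colors_not_constant:
  "proper x \<Longrightarrow> T \<noteq> Leaf \<Longrightarrow> \<exists>f\<in>set (leaf_frames T x). fst f \<noteq> c"
proof (induction T arbitrary: x)
  case (Node l r)
  have children: "proper (child False x)" "proper (child True x)"
    using Node.prems(1) by (simp_all add: proper_child)
  have "fst (child False x) \<noteq> fst (child True x)"
    using Node.prems(1) by (cases x) (auto simp: proper_iff)
  then show ?case
    using Node.IH(1)[OF children(1)] Node.IH(2)[OF children(2)]
    by (cases "l = Leaf"; cases "r = Leaf") (simp_all add: bex_Un, metis)
qed simp

lemma leaf_colors_determine_leaf_frames:
  assumes "proper x" "proper y" "A \<noteq> Leaf"
    and col: "map fst (leaf_frames A x) = map fst (leaf_frames B y)"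
  shows "leaf_frames A x = leaf_frames B y"
proof -
  obtain f fs where A: "leaf_frames A x = f # fs"
    by (cases "leaf_frames A x") auto
  obtain g gs where B: "leaf_frames B y = g # gs"
    by (cases "leaf_frames B y") auto
  have "(f = g \<longrightarrow> fs = gs) \<and> (f \<noteq> g \<longrightarrow> (\<forall>h\<in>set fs. fst h = fst f))"
    using may_follow_leaf_frames[of A x] may_follow_leaf_frames[of B y] col
      proper_leaf_frames[OF assms(1), of _ A] proper_leaf_frames[OF assms(2), of _ B]
    unfolding A B by (intro colors_determine_may_follow_sequence) auto
  moreover have "\<exists>h\<in>set (f # fs). fst h \<noteq> fst f"
    using leaf_colors_not_constant[OF assms(1,3)] by (simp only: A)
  ultimately show ?thesis by (auto simp: A B)
qed

lemma ex_rigid_coloring_iff: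
  assumes "leaves A = leaves B"
  shows "(\<exists>c. rigid_coloring (A, B) c) \<longleftrightarrow>
     (\<exists>x y. proper x \<and> proper y \<and> leaf_frames A x = leaf_frames B y)"
proof -
  have "(\<exists>c. rigid_coloring (A, B) c) \<longleftrightarrow>
     (\<exists>x y. proper x \<and> proper y \<and> map fst (leaf_frames A x) = map fst (leaf_frames B y))"
    unfolding rigid_coloring_def pair_coloring_def fst_conv snd_conv
    using rigid_valid_iff_leaf_frames[of A] rigid_valid_iff_leaf_frames[of B] by metis
  also have "\<dots> \<longleftrightarrow> (\<exists>x y. proper x \<and> proper y \<and> leaf_frames A x = leaf_frames B y)"
  proof (cases "A = Leaf")
    case True
    have "B = Leaf"
    proof (cases B)
      case (Node l r)
      then show ?thesis using assms True leaves_pos[of l] leaves_pos[of r] by simp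
    qed
    \<comment> \<open>Here the color does not determine the frame, but the same frame can be used for both.\<close>
    then show ?thesis using True by auto
  next
    case False
    then show ?thesis by (metis leaf_colors_determine_leaf_frames)
  qed
  finally show ?thesis .
qed


section \<open>Expansions and permutations of the colors\<close>

text \<open>
  A tree that is hung on a leaf unfolds from the frame of this leaf, so what an expansion does to the
  leaf frames depends only on the leaf frames before it.
\<close>

lemma leaf_frames_subst:
  "length fs = leaves A \<Longrightarrow>
     leaf_frames (subst A fs) x = concat (map2 (\<lambda>y f. leaf_frames f y) (leaf_frames A x) fs)"
proof (induction A arbitrary: fs x)
  case Leaf
  then show ?case by (auto simp: length_Suc_conv)
next
  case (Node l r)
  have "zip (leaf_frames (Node l r) x) fs =
      zip (leaf_frames l (child False x)) (take (leaves l) fs) @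
      zip (leaf_frames r (child True x)) (drop (leaves l) fs)"
    by (simp add: zip_append1)
  then show ?case using Node by simp
qed

lemma leaf_frames_subst_cong:
  assumes "leaves A = leaves B" "length fs = leaves A" "leaf_frames A x = leaf_frames B y"
  shows "leaf_frames (subst A fs) x = leaf_frames (subst B fs) y"
  using assms by (simp add: leaf_frames_subst)

definition map_frame :: "(color \<Rightarrow> color) \<Rightarrow> frame \<Rightarrow> frame" where
  "map_frame g = (\<lambda>(p, l, r). (g p, g l, g r))"

lemma child_map_frame: "child b (map_frame g x) = map_frame g (child b x)"
  by (cases x; cases b) (auto simp: map_frame_def)

lemma leaf_frames_map_frame: "leaf_frames T (map_frame g x) = map (map_frame g) (leaf_frames T x)"
  by (induction T arbitrary: x) (auto simp: child_map_frame)

text \<open>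
  Permuting the colors commutes with unfolding, and the permutations act transitively on frames. So
  any two rigid colorings of one tree are equal up to a permutation of the colors, and colorings of
  two pairs can be matched on a tree that the pairs share.
\<close>

lemma ex_map_frame:
  assumes "proper y" "proper z"
  obtains g where "map_frame g z = y" "\<And>w. proper w \<Longrightarrow> proper (map_frame g w)"
proof -
  obtain y1 y2 y3 where y: "y = (y1, y2, y3)" by (cases y)
  obtain z1 z2 z3 where z: "z = (z1, z2, z3)" by (cases z)
  define g where "g = id(z1 := y1, z2 := y2, z3 := y3)"
  have g: "map_frame g z = y"
    using assms(2) by (auto simp: y z g_def map_frame_def proper_iff)
  have "{g z1, g z2, g z3} = {col1, col2, col3}"
    using assms(1) g by (simp add: y z map_frame_def proper_def)
  then have img: "g ` {col1, col2, col3} = {col1, col2, col3}"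
    using assms(2) by (auto simp: z proper_iff)
  have "proper (map_frame g w)" if w: "proper w" for w
  proof -
    obtain w1 w2 w3 where "w = (w1, w2, w3)" by (cases w)
    moreover from this w have "g ` {w1, w2, w3} = {col1, col2, col3}"
      unfolding proper_def by (simp only: prod.case img)
    ultimately show ?thesis by (simp add: proper_def map_frame_def)
  qed
  with g show thesis by (rule that)
qed

lemma leaf_frames_chain:
  assumes "proper x" "proper y" "leaf_frames A x = leaf_frames E y"
    and "proper z" "proper w" "leaf_frames E z = leaf_frames C w"
  shows "\<exists>w'. proper w' \<and> leaf_frames A x = leaf_frames C w'"
proof -
  obtain g where g: "map_frame g z = y" "\<And>w. proper w \<Longrightarrow> proper (map_frame g w)"
    using ex_map_frame[OF assms(2,4)] by blast
  have "leaf_frames A x = leaf_frames C (map_frame g w)"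
    using assms(3,6) by (simp add: leaf_frames_map_frame flip: g(1))
  then show ?thesis using g(2)[OF assms(5)] by blast
qed


section \<open>The subgroup\<close>

lemma has_rigid_coloring_F_classI:
  assumes "leaves A = leaves B" "proper x" "proper y" "leaf_frames A x = leaf_frames B y"
  shows "has_rigid_coloring (F_class A B)"
proof -
  have "(A, B) \<in> F_class A B"
    using assms(1) by (simp add: mem_F_class common_exp_refl tree_pairs_def)
  then show ?thesis
    using assms ex_rigid_coloring_iff[OF assms(1)] unfolding has_rigid_coloring_def by blast
qed

lemma has_rigid_coloringE:
  assumes "X \<in> carrier thompson_F" "has_rigid_coloring X"
  obtains A B x y where "leaves A = leaves B" "X = F_class A B" "proper x" "proper y"
    "leaf_frames A x = leaf_frames B y"
proof -
  obtain A0 B0 where X: "leaves A0 = leaves B0" "X = F_class A0 B0"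
    using assms(1) by (rule F_carrierE)
  obtain A B where AB: "(A, B) \<in> X" "\<exists>c. rigid_coloring (A, B) c"
    using assms(2) by (auto simp: has_rigid_coloring_def)
  have ce: "common_exp (A0, B0) (A, B)" using AB(1) X by (simp add: mem_F_class)
  then have l: "leaves A = leaves B" by (simp add: common_exp_def tree_pairs_def)
  with ce X have "X = F_class A B" by (simp add: F_class_eq_iff)
  with l show thesis using AB(2) that unfolding ex_rigid_coloring_iff[OF l] by blast
qed

theorem proposition9p2:
  shows "subgroup {g \<in> carrier thompson_F. has_rigid_coloring g} thompson_F"
proof (rule group.subgroupI[OF group_thompson_F])
  have "proper (col1, col2, col3)" by (simp add: proper_def)
  then have "has_rigid_coloring (F_class Leaf Leaf)"
    by (intro has_rigid_coloring_F_classI) auto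
  then show "{g \<in> carrier thompson_F. has_rigid_coloring g} \<noteq> {}"
    using F_class_carrier[of Leaf Leaf] by blast
next
  fix X assume "X \<in> {g \<in> carrier thompson_F. has_rigid_coloring g}"
  then obtain A B x y where "leaves A = leaves B" "X = F_class A B" "proper x" "proper y"
    "leaf_frames A x = leaf_frames B y"
    by (auto elim: has_rigid_coloringE)
  then show "inv\<^bsub>thompson_F\<^esub> X \<in> {g \<in> carrier thompson_F. has_rigid_coloring g}"
    using has_rigid_coloring_F_classI[of B A y x] by (simp add: inv_F_class F_class_carrier)
next
  fix X Y
  assume X_in: "X \<in> {g \<in> carrier thompson_F. has_rigid_coloring g}"
    and Y_in: "Y \<in> {g \<in> carrier thompson_F. has_rigid_coloring g}"
  obtain A B x y where X: "leaves A = leaves B" "X = F_class A B" "proper x" "proper y"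
    "leaf_frames A x = leaf_frames B y"
    using X_in by (auto elim: has_rigid_coloringE)
  obtain B' C z w where Y: "leaves B' = leaves C" "Y = F_class B' C" "proper z" "proper w"
    "leaf_frames B' z = leaf_frames C w"
    using Y_in by (auto elim: has_rigid_coloringE)
  obtain fs gs where j: "length fs = leaves B" "length gs = leaves B'" "subst B fs = subst B' gs"
    using subst_join by blast
  \<comment> \<open>Expand both pairs so that the range of the first is the domain of the second.\<close>
  define A2 E C2 where "A2 = subst A fs" and "E = subst B fs" and "C2 = subst C gs"
  have E: "E = subst B' gs" by (simp add: E_def j(3))
  have lA: "leaves A2 = leaves E" using X(1) j(1) by (simp add: A2_def E_def leaves_subst)
  have lC: "leaves E = leaves C2" unfolding E C2_def using Y(1) j(2) by (simp add: leaves_subst)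
  have X2: "X = F_class A2 E" using X(1,2) j(1) by (simp add: A2_def E_def F_class_subst)
  have Y2: "Y = F_class E C2" using Y(1,2) j(2) by (simp add: E C2_def F_class_subst)
  have "leaf_frames A2 x = leaf_frames E y"
    unfolding A2_def E_def using X j(1) by (intro leaf_frames_subst_cong) auto
  moreover have "leaf_frames E z = leaf_frames C2 w"
    unfolding C2_def E using Y j(2) by (intro leaf_frames_subst_cong) auto
  ultimately obtain w' where "proper w'" "leaf_frames A2 x = leaf_frames C2 w'"
    using leaf_frames_chain X(3,4) Y(3,4) by blast
  then have "has_rigid_coloring (F_class A2 C2)"
    using lA lC X(3) by (intro has_rigid_coloring_F_classI) auto
  then show "X \<otimes>\<^bsub>thompson_F\<^esub> Y \<in> {g \<in> carrier thompson_F. has_rigid_coloring g}"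
    using lA lC by (simp add: X2 Y2 F_mult_class F_class_carrier)
qed blast

end
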